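(* Let $q$ be a prime power, $n\ge1$, and let $C=\langle B_r\rangle\oplus\langle B_t\rangle\subseteq\mathbb{F}_q^n$, where $B_r$ ($r\times n$) and $B_t$ ($t\times n$, $t\ge2$) are matrices over $\mathbb{F}_q$ with linearly independent rows, such that $\langle B_r\rangle$ and $\langle B_t\rangle$ are Euclidean orthogonal (i.e. $B_rB_t^T=0$). Suppose $B_t=\begin{pmatrix}B_{t_\ell}\\ B_{t_Q}\end{pmatrix}$ where $B_{t_\ell}$ has $t_\ell$ rows, $\langle B_{t_Q}\rangle\subseteq\langle B_t\rangle^{\perp_e}$, and $Z:=B_{t_\ell}B_{t_\ell}^T$ is a block diagonal matrix whose diagonal blocks are of the form $\begin{pmatrix}0&1\\1&0\end{pmatrix}$ or $(z_i)$ with $z_i\neq0$, and, only in characteristic $2$, possibly one block $\begin{pmatrix}0&1\\1&1\end{pmatrix}$. Let $A=\begin{pmatrix}A_0Z^{-1}&0\\0&A_1\end{pmatrix}$ where $A_0$ is $t_\ell\times t_\ell$ and $A_1$ is $(t-t_\ell)\times(t-t_\ell)$ over $\mathbb{F}_q$, and assume $A$ is invertible and has no eigenvalue in $\mathbb{F}_q$. Let $c=\mathrm{rank}(HH^T)=\dim C-\dim(C\cap C^{\perp_e})$ for a generator matrix $H$ of $C$. Then $D_A$ gives rise to an EAQECC with parameters $[[n,\,n-2r-t+c',\,d';\,c']]_q$ (i.e. $c(D_A)=c'$, $k(D_A)=n-2r-t+c'$, $d(D_A)=d'$), where $$c'=(c-t_\ell)+\tfrac12\mathrm{rank}(A_0-A_0^T)=c-\mathrm{rank}(B_tB_t^T)+\tfrac12\mathrm{rank}(A_0-A_0^T)$$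 and $d'\ge\min\left\{\delta_1,\left\lceil\left(1+\frac1q\right)\delta_2\right\rceil\right\}$ with $\delta_1=d_H(C^{\perp_e})$, $\delta_2=d_H(\langle B_r\rangle^{\perp_e})$.
   Context: $\mathbb{F}_q$ is the finite field with $q$ elements. $x\cdot_e y=\sum_i x_iy_i$ on $\mathbb{F}_q^n$; $V^{\perp_e}$ is the Euclidean dual; $\langle B\rangle$ is the row space of a matrix $B$; $d_H(V)$ is the minimum Hamming weight of a nonzero vector of $V$. On $\mathbb{F}_q^{2n}$, $(x|y)\cdot_s(z|w)=x\cdot_e w-z\cdot_e y$ and $D^{\perp_s}$ is the symplectic dual. The symplectic weight of $(x|y)$ is $\#\{j:(x_j,y_j)\neq(0,0)\}$; $d_s(S)$ is the minimum symplectic weight of a nonzero element of $S$. For a linear code $D\subseteq\mathbb{F}_q^{2n}$: $c(D)=\frac12(\dim D-\dim(D\cap D^{\perp_s}))$, $k(D)=n-\dim D+c(D)$, $d(D)=d_s(D^{\perp_s}\setminus(D\cap D^{\perp_s}))$; $D$ gives rise to an EAQECC with parameters $[[n,k(D),d(D);c(D)]]_q$. $D_A\subseteq\mathbb{F}_q^{2n}$ is the code generated by the rows of $\begin{pmatrix}B_t & AB_t\\ B_r & 0\\ 0 & B_r\end{pmatrix}$. *)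

theory Defs
  imports "Jordan_Normal_Form.DL_Rank" "Jordan_Normal_Form.Gauss_Jordan_Elimination"
    "Jordan_Normal_Form.Char_Poly" "HOL-Library.Extended_Nat"
begin

definition rowsp :: "'a :: field mat \<Rightarrow> 'a vec set" where
  "rowsp B = vec_space.row_space (dim_col B) B"

text \<open>Rows of B are linearly independent (and pairwise distinct, so that the
  number of rows is the dimension of the row space).\<close>
definition indep_rows :: "'a :: field mat \<Rightarrow> bool" where
  "indep_rows B \<longleftrightarrow> distinct (rows B) \<and>
     module.lin_indpt class_ring (module_vec TYPE('a) (dim_col B)) (set (rows B))"

definition code_dim :: "nat \<Rightarrow> 'a :: field vec set \<Rightarrow> nat" where
  "code_dim m W = vectorspace.dim class_ring ((module_vec TYPE('a) m)\<lparr>carrier := W\<rparr>)"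

definition edual :: "nat \<Rightarrow> 'a :: field vec set \<Rightarrow> 'a vec set" where
  "edual m V = vec_module.orthogonal_complement m V"

definition mrank :: "'a :: field mat \<Rightarrow> nat" where
  "mrank M = vec_space.rank (dim_row M) M"

text \<open>Hamming weight and minimum distance (minimum over the empty set is \<infinity>).\<close>
definition hweight :: "'a :: zero vec \<Rightarrow> nat" where
  "hweight v = card {i. i < dim_vec v \<and> v $ i \<noteq> 0}"

definition dH :: "nat \<Rightarrow> 'a :: zero vec set \<Rightarrow> enat" where
  "dH m V = (INF v \<in> {v \<in> V. v \<noteq> 0\<^sub>v m}. enat (hweight v))"

section \<open>Symplectic notions on F^{2n}; a vector (x|y) has x = first n entries\<close>

definition symp :: "nat \<Rightarrow> 'a :: comm_ring vec \<Rightarrow> 'a vec \<Rightarrow> 'a" where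
  "symp n u v = (\<Sum>i<n. u $ i * v $ (n + i)) - (\<Sum>i<n. v $ i * u $ (n + i))"

definition sdual :: "nat \<Rightarrow> 'a :: comm_ring vec set \<Rightarrow> 'a vec set" where
  "sdual n D = {v \<in> carrier_vec (2 * n). \<forall>u \<in> D. symp n u v = 0}"

definition sweight :: "nat \<Rightarrow> 'a :: zero vec \<Rightarrow> nat" where
  "sweight n v = card {j. j < n \<and> (v $ j \<noteq> 0 \<or> v $ (n + j) \<noteq> 0)}"

definition ds :: "nat \<Rightarrow> 'a :: zero vec set \<Rightarrow> enat" where
  "ds n S = (INF v \<in> {v \<in> S. v \<noteq> 0\<^sub>v (2 * n)}. enat (sweight n v))"

text \<open>EAQECC parameters of a linear code D in F^{2n}.  (dim D - dim (D \<inter> D^{\<perp>s}) is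
  always even, so the division by 2 is exact.)\<close>
definition c_of :: "nat \<Rightarrow> 'a :: field vec set \<Rightarrow> int" where
  "c_of n D = (int (code_dim (2 * n) D) - int (code_dim (2 * n) (D \<inter> sdual n D))) div 2"

definition k_of :: "nat \<Rightarrow> 'a :: field vec set \<Rightarrow> int" where
  "k_of n D = int n - int (code_dim (2 * n) D) + c_of n D"

definition d_of :: "nat \<Rightarrow> 'a :: field vec set \<Rightarrow> enat" where
  "d_of n D = ds n (sdual n D - (D \<inter> sdual n D))"

definition hcat :: "'a :: zero mat \<Rightarrow> 'a mat \<Rightarrow> 'a mat" where
  "hcat M N = four_block_mat M N (0\<^sub>m 0 (dim_col M)) (0\<^sub>m 0 (dim_col N))"

fun blockdiag :: "'a :: zero mat list \<Rightarrow> 'a mat" where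
  "blockdiag [] = 0\<^sub>m 0 0"
| "blockdiag (M # Ms) = (let R = blockdiag Ms in
     four_block_mat M (0\<^sub>m (dim_row M) (dim_col R)) (0\<^sub>m (dim_row R) (dim_col M)) R)"

definition hyp_block :: "'a :: {zero,one} mat" where
  "hyp_block = mat_of_rows_list 2 [[0, 1], [1, 0]]"

definition char2_block :: "'a :: {zero,one} mat" where
  "char2_block = mat_of_rows_list 2 [[0, 1], [1, 1]]"

definition Z_shape :: "'a :: field mat \<Rightarrow> bool" where
  "Z_shape Z \<longleftrightarrow> (\<exists>bs. Z = blockdiag bs \<and>
     (\<forall>b \<in> set bs. b = hyp_block \<or> (\<exists>z. z \<noteq> 0 \<and> b = mat_of_rows_list 1 [[z]])
        \<or> (CHAR('a) = 2 \<and> b = char2_block)) \<and>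
     length (filter (\<lambda>b. b = char2_block) bs) \<le> 1)"

definition DA_gen :: "'a :: field mat \<Rightarrow> 'a mat \<Rightarrow> 'a mat \<Rightarrow> 'a mat" where
  "DA_gen A Bt Br = hcat Bt (A * Bt) @\<^sub>r hcat Br (0\<^sub>m (dim_row Br) (dim_col Br))
                    @\<^sub>r hcat (0\<^sub>m (dim_row Br) (dim_col Br)) Br"

definition ceil_factor :: "nat \<Rightarrow> enat \<Rightarrow> enat" where
  "ceil_factor q d = (case d of enat k \<Rightarrow> enat (nat \<lceil>(1 + 1 / real q) * real k\<rceil>) | \<infinity> \<Rightarrow> \<infinity>)"

end

theory Submission
  imports Defs "Jordan_Normal_Form.Matrix_Kernel" "Berlekamp_Zassenhaus.Berlekamp_Type_Based"
begin

text \<open>Over a finite field every dimension is read off from a cardinality, so ranks and dimensions are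
  compared by counting kernels. Put \<open>M = B\<^sub>t B\<^sub>t\<^sup>T\<close>, which is \<open>Z\<close> padded with zeros, and \<open>S = B\<^sub>r B\<^sub>r\<^sup>T\<close>.
  In the coordinates given by the rows, the radical of \<open>C\<close> is \<open>ker S \<times> ker M\<close>, and the symplectic
  radical of \<open>D\<^sub>A\<close> is \<open>ker (A M - M A\<^sup>T) \<times> ker S \<times> ker S\<close>, where \<open>A M - M A\<^sup>T\<close> is \<open>A\<^sub>0 - A\<^sub>0\<^sup>T\<close> padded
  with zeros.

  For the distance, \<open>(x|y)\<close> is in the symplectic dual iff \<open>B\<^sub>r x = B\<^sub>r y = 0\<close> and \<open>B\<^sub>t y = A B\<^sub>t x\<close>. If
  \<open>B\<^sub>t x = 0\<close>, both halves lie in the dual of \<open>C\<close>. Otherwise, as \<open>A\<close> has no eigenvalue, no nontrivial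
  combination \<open>a x + b y\<close> is killed by \<open>B\<^sub>t\<close>, so each has weight at least \<open>\<delta>\<^sub>2\<close>; averaging these
  weights gives the factor \<open>1 + 1/q\<close>.\<close>

section \<open>Counting images, kernels and subspaces over a finite field\<close>

lemma vec_eqI_scalar_prod:
  fixes x y :: "'a :: comm_semiring_1 vec"
  assumes "x \<in> carrier_vec m" "y \<in> carrier_vec m"
    and "\<And>u. u \<in> carrier_vec m \<Longrightarrow> u \<bullet> x = u \<bullet> y"
  shows "x = y"
proof (rule eq_vecI)
  fix i assume "i < dim_vec y"
  then have i: "i < m" using assms by simp
  show "x $ i = y $ i"
    using assms(3)[of "unit_vec m i"] assms(1,2) i by (simp add: scalar_prod_left_unit)
qed (use assms in simp)

text \<open>Every nonempty fibre of \<open>M\<close> is a translate of the kernel, so the domain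
  splits into equally large classes indexed by the image. This is rank-nullity in counted
  form.\<close>

lemma card_mult_mat_vec:
  fixes M :: "'a :: {finite, field} mat"
  assumes M: "M \<in> carrier_mat p k"
  shows "card ((*\<^sub>v) M ` carrier_vec k) * card (mat_kernel M) = CARD('a) ^ k"
proof -
  have fiber: "card {v \<in> carrier_vec k. M *\<^sub>v v = w} = card (mat_kernel M)"
    if "w \<in> (*\<^sub>v) M ` carrier_vec k" for w
  proof -
    from that obtain v where v: "v \<in> carrier_vec k" and w: "w = M *\<^sub>v v" by blast
    have "bij_betw ((+) v) (mat_kernel M) {v \<in> carrier_vec k. M *\<^sub>v v = w}"
    proof (rule bij_betw_byWitness[where f' = "\<lambda>x. x - v"])
      show "(+) v ` mat_kernel M \<subseteq> {v \<in> carrier_vec k. M *\<^sub>v v = w}"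
        using v w M by (auto simp: mat_kernel[OF M] mult_add_distrib_mat_vec[OF M])
      show "(\<lambda>x. x - v) ` {v \<in> carrier_vec k. M *\<^sub>v v = w} \<subseteq> mat_kernel M"
        using v w M by (auto simp: mat_kernel[OF M] mult_minus_distrib_mat_vec[OF M])
    qed (use v in \<open>auto simp: mat_kernel[OF M]\<close>)
    then show ?thesis by (simp add: bij_betw_same_card)
  qed
  have "CARD('a) ^ k = (\<Sum>v\<in>(carrier_vec k :: 'a vec set). 1)"
    by (simp add: card_carrier_vec)
  also have "\<dots> = (\<Sum>w\<in>(*\<^sub>v) M ` carrier_vec k. \<Sum>v\<in>{v \<in> carrier_vec k. M *\<^sub>v v = w}. 1)"
    by (rule sum.image_gen) simp
  also have "\<dots> = (\<Sum>w\<in>(*\<^sub>v) M ` carrier_vec k. card (mat_kernel M))"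
    using fiber by (intro sum.cong) simp_all
  finally show ?thesis by simp
qed

lemma subspaceI_vec:
  fixes W :: "'a :: field vec set"
  assumes "W \<subseteq> carrier_vec m" "0\<^sub>v m \<in> W"
    and "\<And>v w. v \<in> W \<Longrightarrow> w \<in> W \<Longrightarrow> v + w \<in> W"
    and "\<And>a v. v \<in> W \<Longrightarrow> a \<cdot>\<^sub>v v \<in> W"
  shows "VectorSpace.subspace class_ring W (module_vec TYPE('a) m)"
proof -
  interpret vec_space "TYPE('a)" m .
  show ?thesis
    by unfold_locales (use assms in \<open>auto simp: module_vec_simps class_ring_simps\<close>)
qed

text \<open>A nonzero kernel vector is a nontrivial linear relation among the columns. Distinctness
  matters because \<open>set (cols M)\<close> forgets repeated columns.\<close>

lemma mat_kernel_indpt_cols: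
  fixes M :: "'a :: field mat"
  assumes M: "M \<in> carrier_mat m k" and "distinct (cols M)"
    and "module.lin_indpt class_ring (module_vec TYPE('a) m) (set (cols M))"
  shows "mat_kernel M = {0\<^sub>v k}"
proof -
  interpret vec_space "TYPE('a)" m .
  show ?thesis
    using assms lin_depI[OF M] M by (auto simp: mat_kernel[OF M])
qed

text \<open>A basis of \<open>W\<close>, written as the columns of a matrix, parametrises
  \<open>W\<close> injectively by coefficient vectors, and these are counted.\<close>

lemma card_subspace:
  fixes W :: "'a :: {finite, field} vec set"
  assumes W: "VectorSpace.subspace class_ring W (module_vec TYPE('a) m)"
  shows "card W = CARD('a) ^ code_dim m W"
proof -
  interpret vec_space "TYPE('a)" m .
  interpret W: vectorspace class_ring "vs W" by (rule subspace_is_vs[OF W])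
  have sub: "submodule class_ring W V" using W by (simp add: VectorSpace.subspace_def)
  then have Wc: "W \<subseteq> carrier_vec m" by (simp add: submodule_def)
  then have finW: "finite W" by (rule finite_subset) simp
  \<comment> \<open>The finite set \<open>W\<close> spans itself, which is the quickest way to
    finite dimension and hence to a basis.\<close>
  have "W.span W = W"
    using W.in_own_span[of W] W.span_is_subset2[of W] by auto
  then have "W.fin_dim" unfolding W.fin_dim_def using finW by auto
  then obtain B where B: "finite B" "W.basis B" using W.finite_basis_exists by blast
  then have BW: "B \<subseteq> W" and liB: "W.lin_indpt B" and spB: "W.span B = W"
    by (auto simp: W.basis_def)
  \<comment> \<open>Independence and span were obtained inside the subspace \<open>W\<close>; the
    matrix argument needs them in the ambient space.\<close>
  have li: "lin_indpt B" and sp: "span B = W"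
    using span_li_not_depend[OF BW sub] liB spB by auto
  obtain bs where bs: "set bs = B" "distinct bs" using finite_distinct_list B by blast
  define M where "M = mat_of_cols m bs"
  have cM: "cols M = bs" unfolding M_def using bs BW Wc by (intro cols_mat_of_cols) auto
  have M: "M \<in> carrier_mat m (card B)"
    unfolding M_def using bs distinct_card[of bs] by auto
  have im: "W = (*\<^sub>v) M ` carrier_vec (card B)"
    using col_space_eq[OF M] M unfolding col_space_def cM bs sp by auto
  have "mat_kernel M = {0\<^sub>v (card B)}"
    by (rule mat_kernel_indpt_cols[OF M]) (use li bs cM in auto)
  then have "card W = CARD('a) ^ card B"
    using card_mult_mat_vec[OF M] im by simp
  moreover have "code_dim m W = card B"
    unfolding code_dim_def using W.dim_basis B by simp
  ultimately show ?thesis by simp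
qed

text \<open>As \<open>q > 1\<close>, the exponent is determined by the power. This is how every
  dimension below is computed.\<close>

lemma code_dim_eqI:
  fixes W :: "'a :: {finite, field} vec set"
  assumes "VectorSpace.subspace class_ring W (module_vec TYPE('a) m)" and "card W = CARD('a) ^ d"
  shows "code_dim m W = d"
proof -
  have "CARD('a) > 1"
    using card_mono[of UNIV "{0, 1 :: 'a}"] by simp
  then show ?thesis using card_subspace[OF assms(1)] assms(2) by simp
qed

lemma subspace_rowsp:
  fixes B :: "'a :: field mat"
  assumes B: "B \<in> carrier_mat k m"
  shows "VectorSpace.subspace class_ring (rowsp B) (module_vec TYPE('a) m)"
proof -
  interpret vec_space "TYPE('a)" m .
  have "set (rows B) \<subseteq> carrier_vec m" using B rows_carrier[of B] by auto
  then show ?thesis using B span_is_subspace by (auto simp: rowsp_def row_space_def)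
qed

lemma rowsp_eq_image:
  fixes B :: "'a :: field mat"
  assumes B: "B \<in> carrier_mat k m"
  shows "rowsp B = (*\<^sub>v) B\<^sup>T ` carrier_vec k"
  using B vec_space.row_space_eq[OF B] by (auto simp: rowsp_def)

lemma mat_kernel_transpose_indep:
  assumes B: "B \<in> carrier_mat k m" and "indep_rows B"
  shows "mat_kernel B\<^sup>T = {0\<^sub>v k}"
  using assms mat_kernel_indpt_cols[of "B\<^sup>T" m k] by (simp add: indep_rows_def)

lemma mrank_le:
  assumes "M \<in> carrier_mat p k"
  shows "mrank M \<le> k"
  using vec_space.rank_le_nc[OF assms] assms by (simp add: mrank_def)

text \<open>The rank is the dimension of the column space, so the image has
  \<open>q ^ mrank M\<close> elements; dividing this out of \<open>card_mult_mat_vec\<close> leaves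
  the kernel. The truncated subtraction is exact by \<open>mrank_le\<close>.\<close>

lemma card_mat_kernel:
  fixes M :: "'a :: {finite, field} mat"
  assumes M: "M \<in> carrier_mat p k"
  shows "card (mat_kernel M) = CARD('a) ^ (k - mrank M)"
proof -
  interpret vec_space "TYPE('a)" p .
  have cs: "col_space M = (*\<^sub>v) M ` carrier_vec k" using col_space_eq[OF M] M by auto
  have "VectorSpace.subspace class_ring (col_space M) V"
    unfolding col_space_def using M cols_dim[of M] by (intro span_is_subspace) auto
  from card_subspace[OF this]
  have "card ((*\<^sub>v) M ` carrier_vec k) = CARD('a) ^ mrank M"
    unfolding cs[symmetric] using M by (simp add: code_dim_def mrank_def rank_def col_space_def)
  then have "CARD('a) ^ mrank M * card (mat_kernel M) = CARD('a) ^ mrank M * CARD('a) ^ (k - mrank M)"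
    using card_mult_mat_vec[OF M] mrank_le[OF M] by (simp flip: power_add)
  then show ?thesis by simp
qed

text \<open>Moving \<open>B\<^sup>T\<close> across the scalar product turns orthogonality to all row
  combinations into orthogonality of \<open>B *\<^sub>v x\<close> to every vector, and the scalar
  product is nondegenerate.\<close>

lemma edual_rowsp:
  fixes B :: "'a :: field mat"
  assumes B: "B \<in> carrier_mat k m"
  shows "edual m (rowsp B) = mat_kernel B"
proof -
  have "x \<in> edual m (rowsp B) \<longleftrightarrow> x \<in> mat_kernel B" if x: "x \<in> carrier_vec m" for x
  proof -
    have "x \<bullet> (B\<^sup>T *\<^sub>v u) = u \<bullet> (B *\<^sub>v x)" if "u \<in> carrier_vec k" for u
      using transpose_vec_mult_scalar[OF B x that] B x that comm_scalar_prod[of x m "B\<^sup>T *\<^sub>v u"] by simp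
    then have "x \<in> edual m (rowsp B) \<longleftrightarrow> (\<forall>u\<in>carrier_vec k. u \<bullet> (B *\<^sub>v x) = 0)"
      using x by (simp add: edual_def vec_module.orthogonal_complement_def rowsp_eq_image[OF B])
    also have "\<dots> \<longleftrightarrow> B *\<^sub>v x = 0\<^sub>v k"
      using vec_eqI_scalar_prod[of "B *\<^sub>v x" k "0\<^sub>v k"] B x by auto
    finally show ?thesis using x by (simp add: mat_kernel[OF B])
  qed
  then show ?thesis
    using mat_kernel[OF B] by (auto simp: edual_def vec_module.orthogonal_complement_def)
qed

section \<open>Stacked matrices and concatenated vectors\<close>

text \<open>Pairing with an arbitrary \<open>x\<close> moves the transpose to the other side, where
  a stacked matrix simply concatenates its two products.\<close>

lemma transpose_append_rows_mult_vec:
  fixes M N :: "'a :: field mat"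
  assumes M: "M \<in> carrier_mat k m" and N: "N \<in> carrier_mat l m"
    and u: "u \<in> carrier_vec k" and v: "v \<in> carrier_vec l"
  shows "(M @\<^sub>r N)\<^sup>T *\<^sub>v (u @\<^sub>v v) = M\<^sup>T *\<^sub>v u + N\<^sup>T *\<^sub>v v"
proof (rule vec_eqI_scalar_prod)
  fix x :: "'a vec" assume x: "x \<in> carrier_vec m"
  have MN: "M @\<^sub>r N \<in> carrier_mat (k + l) m" using M N by simp
  have c: "M\<^sup>T *\<^sub>v u \<in> carrier_vec m" "N\<^sup>T *\<^sub>v v \<in> carrier_vec m" "(M @\<^sub>r N)\<^sup>T *\<^sub>v (u @\<^sub>v v) \<in> carrier_vec m"
    using M N MN u v by (auto intro!: mult_mat_vec_carrier)
  have "((M @\<^sub>r N)\<^sup>T *\<^sub>v (u @\<^sub>v v)) \<bullet> x = (u @\<^sub>v v) \<bullet> ((M *\<^sub>v x) @\<^sub>v (N *\<^sub>v x))"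
    using transpose_vec_mult_scalar[OF MN x] u v mat_mult_append[OF M N x] by simp
  also have "\<dots> = u \<bullet> (M *\<^sub>v x) + v \<bullet> (N *\<^sub>v x)"
    using M N u v x by (intro scalar_prod_append) auto
  also have "\<dots> = (M\<^sup>T *\<^sub>v u + N\<^sup>T *\<^sub>v v) \<bullet> x"
    using transpose_vec_mult_scalar[OF M x u] transpose_vec_mult_scalar[OF N x v]
      add_scalar_prod_distrib[OF c(1,2) x] by simp
  finally show "x \<bullet> ((M @\<^sub>r N)\<^sup>T *\<^sub>v (u @\<^sub>v v)) = x \<bullet> (M\<^sup>T *\<^sub>v u + N\<^sup>T *\<^sub>v v)"
    using comm_scalar_prod[OF x] c by simp
qed (use M N u v in \<open>auto intro!: mult_mat_vec_carrier add_carrier_vec simp: append_rows_def\<close>)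

lemma hcat_carrier [simp]:
  "M \<in> carrier_mat k m \<Longrightarrow> N \<in> carrier_mat k l \<Longrightarrow> hcat M N \<in> carrier_mat k (m + l)"
  unfolding hcat_def by auto

lemma transpose_hcat_mult_vec:
  fixes M N :: "'a :: field mat"
  assumes M: "M \<in> carrier_mat k m" and N: "N \<in> carrier_mat k l" and u: "u \<in> carrier_vec k"
  shows "(hcat M N)\<^sup>T *\<^sub>v u = (M\<^sup>T *\<^sub>v u) @\<^sub>v (N\<^sup>T *\<^sub>v u)"
proof -
  have "(hcat M N)\<^sup>T = M\<^sup>T @\<^sub>r N\<^sup>T"
    using M N by (intro eq_matI) (auto simp: hcat_def append_rows_def)
  then show ?thesis using mat_mult_append[of "M\<^sup>T" m k "N\<^sup>T" l u] M N u by simp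
qed

lemma carrier_vec_add_eq_append:
  "carrier_vec (k + l) = (\<lambda>(u, v). u @\<^sub>v v) ` (carrier_vec k \<times> carrier_vec l)"
  by (auto simp: image_iff) (metis vec_first_last_append vec_first_carrier vec_last_carrier)

section \<open>Symplectic form, symplectic weight and averaging\<close>

lemma symp_append:
  fixes a b c d :: "'a :: comm_ring vec"
  assumes "a \<in> carrier_vec n" "b \<in> carrier_vec n" "c \<in> carrier_vec n" "d \<in> carrier_vec n"
  shows "symp n (a @\<^sub>v b) (c @\<^sub>v d) = a \<bullet> d - c \<bullet> b"
  using assms by (auto simp: symp_def scalar_prod_def lessThan_atLeast0)

lemma sweight_append:
  assumes "x \<in> carrier_vec n" "y \<in> carrier_vec n"
  shows "sweight n (x @\<^sub>v y) = card {j. j < n \<and> (x $ j \<noteq> 0 \<or> y $ j \<noteq> 0)}"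
  using assms by (auto simp: sweight_def intro!: arg_cong[where f = card])

text \<open>The zero set of a nonzero linear form on the plane is a line with \<open>q\<close>
  points; its complement is counted.\<close>

lemma card_linear_form_nonzero:
  fixes x y :: "'a :: {finite, field}"
  assumes "x \<noteq> 0 \<or> y \<noteq> 0"
  shows "card {(a, b). a * x + b * y \<noteq> 0} = CARD('a) * (CARD('a) - 1)"
proof -
  have *: "card {(a, b). a * x + b * y = 0} = CARD('a)" if "x \<noteq> 0" for x y :: 'a
  proof -
    have "a * x + b * y = 0 \<longleftrightarrow> a = - (b * y) / x" for a b
      unfolding nonzero_eq_divide_eq[OF that] eq_neg_iff_add_eq_0 ..
    then have "{(a, b). a * x + b * y = 0} = range (\<lambda>b. (- (b * y) / x, b))" by auto
    then show ?thesis by (simp add: card_image inj_on_def)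
  qed
  have "card {(a, b). a * x + b * y = 0} = CARD('a)"
  proof (cases "x = 0")
    case True
    \<comment> \<open>Exchanging the two coordinates reduces to a form whose first coefficient is
      nonzero.\<close>
    then have "{(a, b). a * x + b * y = 0} = prod.swap ` {(a, b). a * y + b * x = 0}" by auto
    with True assms *[of y x] show ?thesis by (simp add: card_image)
  qed (use * in simp)
  moreover have "{(a, b). a * x + b * y \<noteq> 0} = UNIV - {(a, b). a * x + b * y = 0}" by auto
  ultimately show ?thesis
    by (simp add: card_Diff_subset diff_mult_distrib2)
qed

text \<open>Each coordinate where \<open>(x|y)\<close> is nonzero is nonzero in exactly \<open>q\<^sup>2 - q\<close> of the
  \<open>q\<^sup>2 - 1\<close> nontrivial combinations \<open>a x + b y\<close>.\<close>

lemma sweight_lower_bound: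
  fixes x y :: "'a :: {finite, field} vec"
  assumes x: "x \<in> carrier_vec n" and y: "y \<in> carrier_vec n"
    and w: "\<And>a b. (a, b) \<noteq> (0, 0) \<Longrightarrow> w \<le> hweight (a \<cdot>\<^sub>v x + b \<cdot>\<^sub>v y)"
  shows "(CARD('a) + 1) * w \<le> CARD('a) * sweight n (x @\<^sub>v y)"
proof -
  let ?q = "CARD('a)"
  let ?J = "{j. j < n \<and> (x $ j \<noteq> 0 \<or> y $ j \<noteq> 0)}"
  let ?P = "UNIV - {(0 :: 'a, 0 :: 'a)}"
  have q: "?q > 1" using card_mono[of UNIV "{0, 1 :: 'a}"] by simp
  have "(?q * ?q - 1) * w = (\<Sum>p\<in>?P. w)"
    by (simp add: card_Diff_subset card_cartesian_product flip: UNIV_Times_UNIV)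
  also have "\<dots> \<le> (\<Sum>(a, b)\<in>?P. hweight (a \<cdot>\<^sub>v x + b \<cdot>\<^sub>v y))"
    using w by (intro sum_mono) auto
  also have "\<dots> = (\<Sum>(a, b)\<in>?P. \<Sum>j<n. of_bool (a * x $ j + b * y $ j \<noteq> 0))"
    using x y by (intro sum.cong refl)
      (auto simp: hweight_def simp flip: of_bool_def intro!: arg_cong[where f = card])
  \<comment> \<open>Double counting: the weights are now summed coordinate by coordinate.\<close>
  also have "\<dots> = (\<Sum>j<n. \<Sum>(a, b)\<in>?P. of_bool (a * x $ j + b * y $ j \<noteq> 0))"
    unfolding case_prod_unfold by (rule sum.swap)
  \<comment> \<open>The excluded pair \<open>(0, 0)\<close> gives the value zero, so it is absent
    from the set on the right as well.\<close>
  also have "\<dots> = (\<Sum>j<n. card {(a, b). a * x $ j + b * y $ j \<noteq> 0})"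
    by (intro sum.cong refl) (auto simp: case_prod_unfold intro!: arg_cong[where f = card])
  also have "\<dots> = (\<Sum>j<n. if j \<in> ?J then ?q * (?q - 1) else 0)"
    using card_linear_form_nonzero[of "x $ j" "y $ j" for j] by (intro sum.cong) auto
  also have "\<dots> = ?q * (?q - 1) * card ?J"
    by (simp add: sum.If_cases) (rule disjI2, rule arg_cong[where f = card], auto)
  \<comment> \<open>Here \<open>q * q - 1\<close> is factored; the common factor
    \<open>q - 1\<close> is positive and cancels.\<close>
  finally have "(?q - 1) * ((?q + 1) * w) \<le> (?q - 1) * (?q * card ?J)"
    by (simp add: algebra_simps)
  with q show ?thesis using sweight_append[OF x y] by simp
qed

lemma hweight_le_sweight:
  assumes "x \<in> carrier_vec n" "y \<in> carrier_vec n"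
  shows "hweight x \<le> sweight n (x @\<^sub>v y)" "hweight y \<le> sweight n (x @\<^sub>v y)"
  using assms by (auto simp: hweight_def sweight_append intro!: card_mono)

lemma dH_le: "v \<in> V \<Longrightarrow> v \<noteq> 0\<^sub>v m \<Longrightarrow> dH m V \<le> enat (hweight v)"
  unfolding dH_def by (rule INF_lower) simp

text \<open>Dividing by \<open>q\<close> gives \<open>(1 + 1/q) * k \<le> s\<close>, and since
  \<open>s\<close> is an integer the bound survives rounding up. The assumption has the shape that
  \<open>sweight_lower_bound\<close> delivers.\<close>

lemma ceil_factor_le:
  assumes "q > 0" and "(q + 1) * k \<le> q * s"
  shows "ceil_factor q (enat k) \<le> enat s"
proof -
  have "(real q + 1) * real k \<le> real q * real s"
    using of_nat_mono[OF assms(2), where 'a = real] by (simp add: algebra_simps)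
  then have "(real q + 1) * real k / real q \<le> real s"
    using assms(1) by (simp add: pos_divide_le_eq mult.commute)
  moreover have "(1 + 1 / real q) * real k = (real q + 1) * real k / real q"
    using assms(1) by (simp add: add_divide_distrib distrib_right)
  ultimately show ?thesis by (simp add: ceil_factor_def ceiling_le_iff nat_le_iff)
qed

section \<open>Invertibility of the Gram block \<open>Z\<close>\<close>

text \<open>The determinant of a block diagonal matrix is the product over its blocks. Squareness is
  part of the conclusion because the induction needs it to fix the sizes of the zero blocks.\<close>

lemma det_blockdiag:
  fixes bs :: "'a :: idom mat list"
  assumes "\<forall>b\<in>set bs. (\<exists>k. b \<in> carrier_mat k k) \<and> det b \<noteq> 0"
  shows "(\<exists>k. blockdiag bs \<in> carrier_mat k k) \<and> det (blockdiag bs) \<noteq> 0"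
  using assms
proof (induction bs)
  case (Cons b bs)
  then obtain k l where b: "b \<in> carrier_mat k k" and R: "blockdiag bs \<in> carrier_mat l l"
    and nz: "det b \<noteq> 0" "det (blockdiag bs) \<noteq> 0" by auto
  have eq: "blockdiag (b # bs) = four_block_mat b (0\<^sub>m k l) (0\<^sub>m l k) (blockdiag bs)"
    using b R by (simp add: Let_def)
  have "det (blockdiag (b # bs)) = det b * det (blockdiag bs)"
    unfolding eq by (rule det_four_block_mat_upper_right_zero[OF b refl _ R]) simp
  moreover have "blockdiag (b # bs) \<in> carrier_mat (k + l) (k + l)"
    unfolding eq using b R by (rule four_block_carrier_mat)
  ultimately show ?case using nz by auto
qed (auto intro: zero_carrier_mat)

lemma Z_shape_det:
  fixes Z :: "'a :: field mat"
  assumes "Z_shape Z"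
  shows "det Z \<noteq> 0"
proof -
  have nz: "det b \<noteq> 0" if "b \<in> carrier_mat k k" "c \<in> carrier_mat k k" "b * c = 1\<^sub>m k" for b c :: "'a mat" and k
    using det_mult[OF that(1,2)] that(3) by auto
  have hyp: "hyp_block \<in> carrier_mat 2 2" and char2: "char2_block \<in> carrier_mat 2 2"
    unfolding hyp_block_def char2_block_def mat_of_rows_list_def by auto
  have "hyp_block * hyp_block = (1\<^sub>m 2 :: 'a mat)"
    unfolding hyp_block_def mat_of_rows_list_def
    by (intro eq_matI) (auto simp: scalar_prod_def numeral_2_eq_2 less_Suc_eq)
  then have "det (hyp_block :: 'a mat) \<noteq> 0" by (rule nz[OF hyp hyp])
  \<comment> \<open>The block \<open>b\<close> satisfies \<open>b * b = b + 1\<close>, so its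
    inverse is \<open>b - 1\<close>, which is the matrix written here.\<close>
  moreover have "char2_block * mat_of_rows_list 2 [[-1, 1], [1, 0]] = (1\<^sub>m 2 :: 'a mat)"
    unfolding char2_block_def mat_of_rows_list_def
    by (intro eq_matI) (auto simp: scalar_prod_def numeral_2_eq_2 less_Suc_eq)
  then have "det (char2_block :: 'a mat) \<noteq> 0"
    by (rule nz[OF char2, rotated]) (auto simp: mat_of_rows_list_def)
  moreover have "det (mat_of_rows_list 1 [[z]]) = z" for z :: 'a
    by (subst det_single) (auto simp: mat_of_rows_list_def)
  moreover have "mat_of_rows_list 1 [[z]] \<in> carrier_mat 1 1" for z :: 'a
    by (auto simp: mat_of_rows_list_def)
  ultimately have "(\<exists>k. b \<in> carrier_mat k k) \<and> det b \<noteq> 0"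
    if "b = hyp_block \<or> (\<exists>z. z \<noteq> 0 \<and> b = mat_of_rows_list 1 [[z]]) \<or> b = char2_block" for b :: "'a mat"
    using that hyp char2 by (elim disjE exE conjE) auto
  with assms det_blockdiag show ?thesis unfolding Z_shape_def by metis
qed

text \<open>This excludes the outcome \<open>None\<close>, so that
  \<open>the (mat_inverse Z)\<close> in the definition of \<open>A\<close> is a genuine two-sided
  inverse.\<close>

lemma mat_inverse_eq_Some:
  fixes Z :: "'a :: field mat"
  assumes Z: "Z \<in> carrier_mat k k" and "det Z \<noteq> 0"
  obtains W where "mat_inverse Z = Some W" "Z * W = 1\<^sub>m k" "W * Z = 1\<^sub>m k" "W \<in> carrier_mat k k"
  using mat_inverse(1)[OF Z, of "()"] mat_inverse(2)[OF Z] det_non_zero_imp_unit[OF assms, of "()"]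
  by (cases "mat_inverse Z") auto


section \<open>Kernels, Euclidean radicals and block matrices\<close>

lemma mult_mat_zero_vec:
  fixes M :: "'a :: semiring_0 mat"
  assumes "M \<in> carrier_mat p k"
  shows "M *\<^sub>v 0\<^sub>v k = 0\<^sub>v p"
  using assms by (intro eq_vecI) auto

lemma zero_mat_mult_vec:
  fixes a :: "'a :: semiring_0 vec"
  assumes "a \<in> carrier_vec l"
  shows "0\<^sub>m k l *\<^sub>v a = 0\<^sub>v k"
  using assms by (intro eq_vecI) auto

lemma inj_on_mult_mat_vec:
  fixes M :: "'a :: field mat"
  assumes M: "M \<in> carrier_mat p k" and ker: "mat_kernel M = {0\<^sub>v k}"
  shows "inj_on ((*\<^sub>v) M) (carrier_vec k)"
proof (rule inj_onI)
  fix u v :: "'a vec" assume u: "u \<in> carrier_vec k" and v: "v \<in> carrier_vec k" and eq: "M *\<^sub>v u = M *\<^sub>v v"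
  then have "u - v \<in> mat_kernel M"
    using M by (simp add: mat_kernel[OF M] mult_minus_distrib_mat_vec[OF M])
  then have *: "u - v = 0\<^sub>v k" using ker by simp
  have "(u - v) + v = u" using u v by auto
  then show "u = v" using * v by simp
qed

lemma code_dim_rowsp:
  fixes N :: "'a :: {finite, field} mat"
  assumes N: "N \<in> carrier_mat k m" and ker: "mat_kernel N\<^sup>T = {0\<^sub>v k}"
  shows "code_dim m (rowsp N) = k"
proof (rule code_dim_eqI[OF subspace_rowsp[OF N]])
  show "card (rowsp N) = CARD('a) ^ k"
    using card_mult_mat_vec[of "N\<^sup>T" m k] N ker by (simp add: rowsp_eq_image[OF N])
qed

lemma subspace_Int_vec:
  fixes U W :: "'a :: field vec set"
  assumes "VectorSpace.subspace class_ring U (module_vec TYPE('a) m)"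
    and "VectorSpace.subspace class_ring W (module_vec TYPE('a) m)"
  shows "VectorSpace.subspace class_ring (U \<inter> W) (module_vec TYPE('a) m)"
  using assms
  by (intro subspaceI_vec) (auto simp: VectorSpace.subspace_def submodule_def module_vec_simps class_ring_simps)

lemma subspace_mat_kernel:
  fixes M :: "'a :: field mat"
  assumes M: "M \<in> carrier_mat p k"
  shows "VectorSpace.subspace class_ring (mat_kernel M) (module_vec TYPE('a) k)"
  by (rule subspaceI_vec)
    (use M in \<open>auto simp: mat_kernel[OF M] mult_add_distrib_mat_vec[OF M] mult_mat_vec[OF M]\<close>)

text \<open>A codeword \<open>N\<^sup>T *\<^sub>v u\<close> is orthogonal to the whole code exactly
  when the Gram matrix \<open>N * N\<^sup>T\<close> kills \<open>u\<close>, and by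
  \<open>ker\<close> distinct \<open>u\<close> give distinct codewords.\<close>

lemma card_rowsp_Int_edual:
  fixes N :: "'a :: {finite, field} mat"
  assumes N: "N \<in> carrier_mat k m" and ker: "mat_kernel N\<^sup>T = {0\<^sub>v k}"
  shows "card (rowsp N \<inter> edual m (rowsp N)) = card (mat_kernel (N * N\<^sup>T))"
proof -
  have NT: "N\<^sup>T \<in> carrier_mat m k" and NN: "N * N\<^sup>T \<in> carrier_mat k k" using N by auto
  have "rowsp N \<inter> edual m (rowsp N) = (*\<^sub>v) N\<^sup>T ` mat_kernel (N * N\<^sup>T)"
    unfolding edual_rowsp[OF N] unfolding rowsp_eq_image[OF N] mat_kernel[OF N] mat_kernel[OF NN]
    using assoc_mult_mat_vec[OF N NT] NT by auto
  moreover have "inj_on ((*\<^sub>v) N\<^sup>T) (mat_kernel (N * N\<^sup>T))"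
    using inj_on_mult_mat_vec[OF NT ker] mat_kernel_carrier[OF NN] by (rule inj_on_subset)
  ultimately show ?thesis by (simp add: card_image)
qed

lemma mult_mat_eq_0I:
  fixes P Q :: "'a :: field mat"
  assumes P: "P \<in> carrier_mat k m" and Q: "Q \<in> carrier_mat m l"
    and "\<And>y. y \<in> carrier_vec l \<Longrightarrow> P *\<^sub>v (Q *\<^sub>v y) = 0\<^sub>v k"
  shows "P * Q = 0\<^sub>m k l"
proof (rule eq_matI)
  fix i j assume "i < dim_row (0\<^sub>m k l :: 'a mat)" "j < dim_col (0\<^sub>m k l :: 'a mat)"
  then have i: "i < k" and j: "j < l" by auto
  have R: "P * Q \<in> carrier_mat k l" using P Q by simp
  \<comment> \<open>A unit vector extracts column \<open>j\<close> of the product.\<close>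
  have "(P * Q) *\<^sub>v unit_vec l j = 0\<^sub>v k"
    using assms by (simp add: assoc_mult_mat_vec[OF P Q])
  moreover have "(R *\<^sub>v unit_vec l j) $ i = R $$ (i, j)" if "R \<in> carrier_mat k l" for R :: "'a mat"
    using that i j by (simp add: scalar_prod_right_unit)
  ultimately show "(P * Q) $$ (i, j) = 0\<^sub>m k l $$ (i, j)" using i j R by fastforce
qed (use P Q in auto)

lemma append_rows_mult_transpose:
  fixes M N :: "'a :: field mat"
  assumes M: "M \<in> carrier_mat k m" and N: "N \<in> carrier_mat l m"
  shows "(M @\<^sub>r N) * (M @\<^sub>r N)\<^sup>T = four_block_mat (M * M\<^sup>T) (M * N\<^sup>T) (N * M\<^sup>T) (N * N\<^sup>T)"
proof -
  \<comment> \<open>Blocks of width or height zero present both factors as four-block matrices, so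
    that the block product rule applies.\<close>
  have "(M @\<^sub>r N)\<^sup>T = four_block_mat M\<^sup>T N\<^sup>T (0\<^sub>m 0 k) (0\<^sub>m 0 l)"
    using M N by (intro eq_matI) (auto simp: append_rows_def)
  moreover have "M @\<^sub>r N = four_block_mat M (0\<^sub>m k 0) N (0\<^sub>m l 0)"
    using M N by (simp add: append_rows_def)
  moreover have "four_block_mat M (0\<^sub>m k 0) N (0\<^sub>m l 0) * four_block_mat M\<^sup>T N\<^sup>T (0\<^sub>m 0 k) (0\<^sub>m 0 l) =
    four_block_mat (M * M\<^sup>T + 0\<^sub>m k 0 * 0\<^sub>m 0 k) (M * N\<^sup>T + 0\<^sub>m k 0 * 0\<^sub>m 0 l)
      (N * M\<^sup>T + 0\<^sub>m l 0 * 0\<^sub>m 0 k) (N * N\<^sup>T + 0\<^sub>m l 0 * 0\<^sub>m 0 l)"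
    by (rule mult_four_block_mat) (use M N in auto)
  ultimately show ?thesis using M N by simp
qed

lemma card_mat_kernel_block_diag:
  fixes P Q :: "'a :: {finite, field} mat"
  assumes P: "P \<in> carrier_mat k k" and Q: "Q \<in> carrier_mat l l"
  shows "card (mat_kernel (four_block_mat P (0\<^sub>m k l) (0\<^sub>m l k) Q)) =
    card (mat_kernel P) * card (mat_kernel Q)"
proof -
  let ?F = "four_block_mat P (0\<^sub>m k l) (0\<^sub>m l k) Q"
  have F: "?F \<in> carrier_mat (k + l) (k + l)" using P Q by simp
  have zero: "0\<^sub>v (k + l) = (0\<^sub>v k @\<^sub>v 0\<^sub>v l :: 'a vec)" by auto
  have iff: "u @\<^sub>v v \<in> mat_kernel ?F \<longleftrightarrow> u \<in> mat_kernel P \<and> v \<in> mat_kernel Q"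
    if "u \<in> carrier_vec k" "v \<in> carrier_vec l" for u v
    using that P Q mult_mat_vec_split[OF P Q that(1,2)]
      append_vec_eq[of "P *\<^sub>v u" k "0\<^sub>v k" "Q *\<^sub>v v" "0\<^sub>v l"]
    by (simp add: mat_kernel[OF F] mat_kernel[OF P] mat_kernel[OF Q] zero)
  have "mat_kernel ?F = (\<lambda>(u, v). u @\<^sub>v v) ` (mat_kernel P \<times> mat_kernel Q)"
  proof (intro equalityI subsetI)
    fix z assume z: "z \<in> mat_kernel ?F"
    then have "z \<in> carrier_vec (k + l)" using mat_kernel_carrier[OF F] by blast
    then obtain u v where "u \<in> carrier_vec k" "v \<in> carrier_vec l" "z = u @\<^sub>v v"
      unfolding carrier_vec_add_eq_append by auto
    with z iff show "z \<in> (\<lambda>(u, v). u @\<^sub>v v) ` (mat_kernel P \<times> mat_kernel Q)" by auto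
  next
    fix z assume "z \<in> (\<lambda>(u, v). u @\<^sub>v v) ` (mat_kernel P \<times> mat_kernel Q)"
    then obtain u v where uv: "u \<in> mat_kernel P" "v \<in> mat_kernel Q" and z: "z = u @\<^sub>v v" by auto
    then have "u \<in> carrier_vec k" "v \<in> carrier_vec l"
      using mat_kernel_carrier[OF P] mat_kernel_carrier[OF Q] by auto
    then show "z \<in> mat_kernel ?F" unfolding z using iff uv by blast
  qed
  moreover have "inj_on (\<lambda>(u, v). u @\<^sub>v v) (mat_kernel P \<times> mat_kernel Q)"
    using P by (auto simp: inj_on_def mat_kernel[OF P] append_vec_eq)
  ultimately show ?thesis
    by (simp add: card_image card_cartesian_product)
qed

lemma mat_kernel_zero: "mat_kernel (0\<^sub>m k l) = carrier_vec l"
  by (auto simp: mat_kernel_def)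

lemma mult_mat_transpose_swap:
  fixes M N :: "'a :: comm_ring_1 mat"
  assumes "M \<in> carrier_mat k m" "N \<in> carrier_mat l m" "M * N\<^sup>T = 0\<^sub>m k l"
  shows "N * M\<^sup>T = 0\<^sub>m l k"
  using arg_cong[OF assms(3), of transpose_mat] transpose_mult[OF assms(1), of "N\<^sup>T" l] assms(2) by simp

section \<open>The code generated by \<open>DA_gen\<close>, its symplectic dual and its
  radical\<close>

text \<open>The vectors \<open>u\<close>, \<open>v\<close>, \<open>w\<close> are the coefficients of
  the three block rows. Row combinations act from the left, which is why \<open>A\<close> appears
  transposed.\<close>

lemma rowsp_DA_gen:
  fixes A Bt Br :: "'a :: field mat"
  assumes Br: "Br \<in> carrier_mat r n" and Bt: "Bt \<in> carrier_mat t n" and A: "A \<in> carrier_mat t t"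
  shows "DA_gen A Bt Br \<in> carrier_mat (t + (r + r)) (n + n)"
    and "rowsp (DA_gen A Bt Br) =
      (\<lambda>(u, v, w). (Bt\<^sup>T *\<^sub>v u + Br\<^sup>T *\<^sub>v v) @\<^sub>v (Bt\<^sup>T *\<^sub>v (A\<^sup>T *\<^sub>v u) + Br\<^sup>T *\<^sub>v w)) `
        (carrier_vec t \<times> carrier_vec r \<times> carrier_vec r)"
proof -
  let ?G = "DA_gen A Bt Br"
  have AB: "A * Bt \<in> carrier_mat t n" using A Bt by simp
  have G1: "hcat Bt (A * Bt) \<in> carrier_mat t (n + n)" using Bt AB by simp
  have G2: "hcat Br (0\<^sub>m r n) \<in> carrier_mat r (n + n)" and G3: "hcat (0\<^sub>m r n) Br \<in> carrier_mat r (n + n)"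
    using Br by simp_all
  have G23: "hcat Br (0\<^sub>m r n) @\<^sub>r hcat (0\<^sub>m r n) Br \<in> carrier_mat (r + r) (n + n)"
    using G2 G3 by simp
  have G_eq: "?G = hcat Bt (A * Bt) @\<^sub>r hcat Br (0\<^sub>m r n) @\<^sub>r hcat (0\<^sub>m r n) Br"
    using Br by (simp add: DA_gen_def)
  show G: "?G \<in> carrier_mat (t + (r + r)) (n + n)"
    unfolding G_eq using G1 G23 by simp
  have "?G\<^sup>T *\<^sub>v (u @\<^sub>v (v @\<^sub>v w)) =
      (Bt\<^sup>T *\<^sub>v u + Br\<^sup>T *\<^sub>v v) @\<^sub>v (Bt\<^sup>T *\<^sub>v (A\<^sup>T *\<^sub>v u) + Br\<^sup>T *\<^sub>v w)"
    if u: "u \<in> carrier_vec t" and v: "v \<in> carrier_vec r" and w: "w \<in> carrier_vec r" for u v w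
  proof -
    have c: "Bt\<^sup>T *\<^sub>v u \<in> carrier_vec n" "Br\<^sup>T *\<^sub>v v \<in> carrier_vec n" "Br\<^sup>T *\<^sub>v w \<in> carrier_vec n"
      "Bt\<^sup>T *\<^sub>v (A\<^sup>T *\<^sub>v u) \<in> carrier_vec n"
      using Bt Br A u v w by (auto intro!: mult_mat_vec_carrier)
    have "(A * Bt)\<^sup>T *\<^sub>v u = Bt\<^sup>T *\<^sub>v (A\<^sup>T *\<^sub>v u)"
      using transpose_mult[OF A Bt] A Bt u by (simp add: assoc_mult_mat_vec[of _ n t _ t])
    then have "?G\<^sup>T *\<^sub>v (u @\<^sub>v (v @\<^sub>v w)) =
        ((Bt\<^sup>T *\<^sub>v u) @\<^sub>v (Bt\<^sup>T *\<^sub>v (A\<^sup>T *\<^sub>v u))) + (((Br\<^sup>T *\<^sub>v v) @\<^sub>v 0\<^sub>v n) + (0\<^sub>v n @\<^sub>v (Br\<^sup>T *\<^sub>v w)))"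
      unfolding G_eq
      using transpose_append_rows_mult_vec[OF G1 G23 u, of "v @\<^sub>v w"] transpose_append_rows_mult_vec[OF G2 G3 v w]
        transpose_hcat_mult_vec[OF Bt AB u] transpose_hcat_mult_vec[OF Br zero_carrier_mat v]
        transpose_hcat_mult_vec[OF zero_carrier_mat Br w] v w
        zero_mat_mult_vec[OF v] zero_mat_mult_vec[OF w]
      by simp
    moreover have "(a @\<^sub>v b) + ((c @\<^sub>v 0\<^sub>v n) + (0\<^sub>v n @\<^sub>v d)) = (a + c) @\<^sub>v (b + d)"
      if "a \<in> carrier_vec n" "b \<in> carrier_vec n" "c \<in> carrier_vec n" "d \<in> carrier_vec n"
      for a b c d :: "'a vec"
      using that by (intro eq_vecI) auto
    note this[OF c(1,4,2,3)]
    ultimately show ?thesis by simp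
  qed
  then show "rowsp ?G = (\<lambda>(u, v, w). (Bt\<^sup>T *\<^sub>v u + Br\<^sup>T *\<^sub>v v) @\<^sub>v (Bt\<^sup>T *\<^sub>v (A\<^sup>T *\<^sub>v u) + Br\<^sup>T *\<^sub>v w)) `
        (carrier_vec t \<times> carrier_vec r \<times> carrier_vec r)"
    unfolding rowsp_eq_image[OF G] carrier_vec_add_eq_append image_image
    by (force simp: image_iff)
qed

text \<open>After moving all transposes across, the symplectic product with a codeword is linear in
  \<open>u\<close>, \<open>v\<close>, \<open>w\<close> separately. Setting two of them to zero
  isolates one of the three conditions.\<close>

lemma sdual_rowsp_DA_gen:
  fixes A Bt Br :: "'a :: field mat"
  assumes Br: "Br \<in> carrier_mat r n" and Bt: "Bt \<in> carrier_mat t n" and A: "A \<in> carrier_mat t t"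
    and x: "x \<in> carrier_vec n" and y: "y \<in> carrier_vec n"
  shows "x @\<^sub>v y \<in> sdual n (rowsp (DA_gen A Bt Br)) \<longleftrightarrow>
    Br *\<^sub>v x = 0\<^sub>v r \<and> Br *\<^sub>v y = 0\<^sub>v r \<and> Bt *\<^sub>v y = A *\<^sub>v (Bt *\<^sub>v x)"
proof -
  have c: "Bt *\<^sub>v y \<in> carrier_vec t" "A *\<^sub>v (Bt *\<^sub>v x) \<in> carrier_vec t" "Br *\<^sub>v x \<in> carrier_vec r" "Br *\<^sub>v y \<in> carrier_vec r"
    "Bt *\<^sub>v x \<in> carrier_vec t"
    using Br Bt A x y by (auto intro!: mult_mat_vec_carrier)
  have symp: "symp n ((Bt\<^sup>T *\<^sub>v u + Br\<^sup>T *\<^sub>v v) @\<^sub>v (Bt\<^sup>T *\<^sub>v (A\<^sup>T *\<^sub>v u) + Br\<^sup>T *\<^sub>v w)) (x @\<^sub>v y) =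
      u \<bullet> (Bt *\<^sub>v y) - u \<bullet> (A *\<^sub>v (Bt *\<^sub>v x)) + v \<bullet> (Br *\<^sub>v y) - w \<bullet> (Br *\<^sub>v x)"
    if u: "u \<in> carrier_vec t" and v: "v \<in> carrier_vec r" and w: "w \<in> carrier_vec r" for u v w
  proof -
    have Au: "A\<^sup>T *\<^sub>v u \<in> carrier_vec t" using A u by (auto intro!: mult_mat_vec_carrier)
    have d: "Bt\<^sup>T *\<^sub>v u \<in> carrier_vec n" "Br\<^sup>T *\<^sub>v v \<in> carrier_vec n" "Br\<^sup>T *\<^sub>v w \<in> carrier_vec n"
      "Bt\<^sup>T *\<^sub>v (A\<^sup>T *\<^sub>v u) \<in> carrier_vec n"
      using Bt Br u v w Au by (auto intro!: mult_mat_vec_carrier)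
    have "symp n ((Bt\<^sup>T *\<^sub>v u + Br\<^sup>T *\<^sub>v v) @\<^sub>v (Bt\<^sup>T *\<^sub>v (A\<^sup>T *\<^sub>v u) + Br\<^sup>T *\<^sub>v w)) (x @\<^sub>v y) =
        (Bt\<^sup>T *\<^sub>v u + Br\<^sup>T *\<^sub>v v) \<bullet> y - (Bt\<^sup>T *\<^sub>v (A\<^sup>T *\<^sub>v u) + Br\<^sup>T *\<^sub>v w) \<bullet> x"
      using d x y comm_scalar_prod[OF x] by (simp add: symp_append)
    also have "\<dots> = u \<bullet> (Bt *\<^sub>v y) + v \<bullet> (Br *\<^sub>v y) - ((A\<^sup>T *\<^sub>v u) \<bullet> (Bt *\<^sub>v x) + w \<bullet> (Br *\<^sub>v x))"
      using d x y add_scalar_prod_distrib[OF d(1,2) y] add_scalar_prod_distrib[OF d(4,3) x]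
        transpose_vec_mult_scalar[OF Bt y u] transpose_vec_mult_scalar[OF Br y v]
        transpose_vec_mult_scalar[OF Bt x Au] transpose_vec_mult_scalar[OF Br x w] by simp
    finally show ?thesis using transpose_vec_mult_scalar[OF A c(5) u] by simp
  qed
  have "x @\<^sub>v y \<in> sdual n (rowsp (DA_gen A Bt Br)) \<longleftrightarrow>
    (\<forall>u\<in>carrier_vec t. \<forall>v\<in>carrier_vec r. \<forall>w\<in>carrier_vec r.
      u \<bullet> (Bt *\<^sub>v y) - u \<bullet> (A *\<^sub>v (Bt *\<^sub>v x)) + v \<bullet> (Br *\<^sub>v y) - w \<bullet> (Br *\<^sub>v x) = 0)" (is "_ \<longleftrightarrow> ?P")
    using x y symp by (auto simp: sdual_def rowsp_DA_gen(2)[OF Br Bt A] mult_2)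
  also have "\<dots> \<longleftrightarrow> Br *\<^sub>v x = 0\<^sub>v r \<and> Br *\<^sub>v y = 0\<^sub>v r \<and> Bt *\<^sub>v y = A *\<^sub>v (Bt *\<^sub>v x)"
  proof
    assume P: ?P
    have "Br *\<^sub>v x = 0\<^sub>v r"
    proof (rule vec_eqI_scalar_prod)
      fix w :: "'a vec" assume "w \<in> carrier_vec r"
      with P[rule_format, of "0\<^sub>v t" "0\<^sub>v r" w] c show "w \<bullet> (Br *\<^sub>v x) = w \<bullet> 0\<^sub>v r" by simp
    qed (use c in auto)
    moreover have "Br *\<^sub>v y = 0\<^sub>v r"
    proof (rule vec_eqI_scalar_prod)
      fix w :: "'a vec" assume "w \<in> carrier_vec r"
      with P[rule_format, of "0\<^sub>v t" w "0\<^sub>v r"] c show "w \<bullet> (Br *\<^sub>v y) = w \<bullet> 0\<^sub>v r" by simp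
    qed (use c in auto)
    moreover have "Bt *\<^sub>v y = A *\<^sub>v (Bt *\<^sub>v x)"
    proof (rule vec_eqI_scalar_prod)
      fix u :: "'a vec" assume "u \<in> carrier_vec t"
      with P[rule_format, of u "0\<^sub>v r" "0\<^sub>v r"] c
      show "u \<bullet> (Bt *\<^sub>v y) = u \<bullet> (A *\<^sub>v (Bt *\<^sub>v x))" by simp
    qed (use c in auto)
    ultimately show "Br *\<^sub>v x = 0\<^sub>v r \<and> Br *\<^sub>v y = 0\<^sub>v r \<and> Bt *\<^sub>v y = A *\<^sub>v (Bt *\<^sub>v x)" by blast
  qed (use c in simp)
  finally show ?thesis .
qed

lemma subspace_sdual:
  fixes D :: "'a :: field vec set"
  shows "VectorSpace.subspace class_ring (sdual n D) (module_vec TYPE('a) (2 * n))"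
  by (rule subspaceI_vec)
    (auto simp: sdual_def symp_def distrib_left distrib_right sum.distrib mult.assoc mult.left_commute
      simp flip: sum_distrib_left right_diff_distrib)

text \<open>The parametrisation by \<open>(u, v, w)\<close> is injective. Inserting a codeword into
  the criterion of \<open>sdual_rowsp_DA_gen\<close>, orthogonality of \<open>Br\<close> and
  \<open>Bt\<close> decouples the conditions: one on \<open>u\<close>, and one each on
  \<open>v\<close> and \<open>w\<close> through the same Gram matrix, hence the square.\<close>

lemma DA_gen_radical:
  fixes A Bt Br :: "'a :: {finite, field} mat"
  assumes Br: "Br \<in> carrier_mat r n" and Bt: "Bt \<in> carrier_mat t n" and A: "A \<in> carrier_mat t t"
    and kBr: "mat_kernel Br\<^sup>T = {0\<^sub>v r}" and kC: "mat_kernel (Br @\<^sub>r Bt)\<^sup>T = {0\<^sub>v (r + t)}"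
    and orth: "Br * Bt\<^sup>T = 0\<^sub>m r t"
  defines "D \<equiv> rowsp (DA_gen A Bt Br)"
  defines "M \<equiv> Bt * Bt\<^sup>T"
  shows "card D = CARD('a) ^ (t + (r + r))"
    and "card (D \<inter> sdual n D) =
      card (mat_kernel (A * M - M * A\<^sup>T)) * card (mat_kernel (Br * Br\<^sup>T)) ^ 2"
proof -
  let ?\<phi> = "\<lambda>(u, v, w). (Bt\<^sup>T *\<^sub>v u + Br\<^sup>T *\<^sub>v v) @\<^sub>v (Bt\<^sup>T *\<^sub>v (A\<^sup>T *\<^sub>v u) + Br\<^sup>T *\<^sub>v w)"
  let ?dom = "carrier_vec t \<times> carrier_vec r \<times> carrier_vec r :: ('a vec \<times> 'a vec \<times> 'a vec) set"
  let ?S = "Br * Br\<^sup>T" and ?K = "A * M - M * A\<^sup>T"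
  have T: "Br\<^sup>T \<in> carrier_mat n r" "Bt\<^sup>T \<in> carrier_mat n t" "A\<^sup>T \<in> carrier_mat t t" using Br Bt A by auto
  have M: "M \<in> carrier_mat t t" and S: "?S \<in> carrier_mat r r" and K: "?K \<in> carrier_mat t t"
    using Br Bt A unfolding M_def by auto
  have orth': "Bt * Br\<^sup>T = 0\<^sub>m t r" by (rule mult_mat_transpose_swap[OF Br Bt orth])
  have D_eq: "D = ?\<phi> ` ?dom" unfolding D_def by (rule rowsp_DA_gen(2)[OF Br Bt A])
  have inj: "inj_on ?\<phi> ?dom"
  proof (rule inj_onI)
    fix p p' assume p: "p \<in> ?dom" "p' \<in> ?dom" "?\<phi> p = ?\<phi> p'"
    obtain u v w u' v' w' where pe: "p = (u, v, w)" "p' = (u', v', w')"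
      by (metis surj_pair)
    then have c: "u \<in> carrier_vec t" "v \<in> carrier_vec r" "w \<in> carrier_vec r"
      "u' \<in> carrier_vec t" "v' \<in> carrier_vec r" "w' \<in> carrier_vec r"
      and eq: "(Bt\<^sup>T *\<^sub>v u + Br\<^sup>T *\<^sub>v v) @\<^sub>v (Bt\<^sup>T *\<^sub>v (A\<^sup>T *\<^sub>v u) + Br\<^sup>T *\<^sub>v w) =
        (Bt\<^sup>T *\<^sub>v u' + Br\<^sup>T *\<^sub>v v') @\<^sub>v (Bt\<^sup>T *\<^sub>v (A\<^sup>T *\<^sub>v u') + Br\<^sup>T *\<^sub>v w')"
      using p by simp_all
    have d: "Bt\<^sup>T *\<^sub>v u \<in> carrier_vec n" "Br\<^sup>T *\<^sub>v v \<in> carrier_vec n" "Bt\<^sup>T *\<^sub>v u' \<in> carrier_vec n"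
      "Br\<^sup>T *\<^sub>v v' \<in> carrier_vec n" "Br\<^sup>T *\<^sub>v w \<in> carrier_vec n" "Br\<^sup>T *\<^sub>v w' \<in> carrier_vec n"
      "Bt\<^sup>T *\<^sub>v (A\<^sup>T *\<^sub>v u) \<in> carrier_vec n"
      using T c by (meson mult_mat_vec_carrier)+
    from eq have eq1: "Bt\<^sup>T *\<^sub>v u + Br\<^sup>T *\<^sub>v v = Bt\<^sup>T *\<^sub>v u' + Br\<^sup>T *\<^sub>v v'"
      and eq2: "Bt\<^sup>T *\<^sub>v (A\<^sup>T *\<^sub>v u) + Br\<^sup>T *\<^sub>v w = Bt\<^sup>T *\<^sub>v (A\<^sup>T *\<^sub>v u') + Br\<^sup>T *\<^sub>v w'"
      using d append_vec_eq[of "Bt\<^sup>T *\<^sub>v u + Br\<^sup>T *\<^sub>v v" n "Bt\<^sup>T *\<^sub>v u' + Br\<^sup>T *\<^sub>v v'"] by simp_all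
    \<comment> \<open>The first halves alone determine \<open>v\<close> and \<open>u\<close> by
      \<open>kC\<close>. The second halves can then differ only in their \<open>Br\<close> part, and
      \<open>kBr\<close> yields \<open>w\<close>.\<close>
    have "(Br @\<^sub>r Bt)\<^sup>T *\<^sub>v (v @\<^sub>v u) = (Br @\<^sub>r Bt)\<^sup>T *\<^sub>v (v' @\<^sub>v u')"
      using transpose_append_rows_mult_vec[OF Br Bt] c d eq1
      by (simp add: comm_add_vec[of _ n])
    then have "v @\<^sub>v u = v' @\<^sub>v u'"
      using inj_on_mult_mat_vec[OF _ kC, of n] Br Bt c by (auto simp: inj_on_def)
    then have vu: "v = v'" "u = u'" using c append_vec_eq[of v r v'] by auto
    have "b = c" if "a + b = a + c" "a \<in> carrier_vec n" "b \<in> carrier_vec n" "c \<in> carrier_vec n" for a b c :: "'a vec"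
      using that by (auto simp: vec_eq_iff)
    with eq2 d vu have "Br\<^sup>T *\<^sub>v w = Br\<^sup>T *\<^sub>v w'" by blast
    then have "w = w'"
      using inj_on_mult_mat_vec[OF T(1) kBr] c by (auto simp: inj_on_def)
    with vu pe show "p = p'" by simp
  qed
  show "card D = CARD('a) ^ (t + (r + r))"
    unfolding D_eq card_image[OF inj] by (simp add: card_cartesian_product card_carrier_vec power_add)
  have "?\<phi> (u, v, w) \<in> sdual n D \<longleftrightarrow> u \<in> mat_kernel ?K \<and> v \<in> mat_kernel ?S \<and> w \<in> mat_kernel ?S"
    if c: "u \<in> carrier_vec t" "v \<in> carrier_vec r" "w \<in> carrier_vec r" for u v w
  proof -
    have Au: "A\<^sup>T *\<^sub>v u \<in> carrier_vec t" using T(3) c(1) by (rule mult_mat_vec_carrier)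
    \<comment> \<open>Stated for arbitrary coefficients because the two halves of a codeword use
      \<open>(u, v)\<close> and \<open>(A\<^sup>T *\<^sub>v u, w)\<close>.\<close>
    have sum1: "Br *\<^sub>v (Bt\<^sup>T *\<^sub>v a + Br\<^sup>T *\<^sub>v b) = ?S *\<^sub>v b"
      and sum2: "Bt *\<^sub>v (Bt\<^sup>T *\<^sub>v a + Br\<^sup>T *\<^sub>v b) = M *\<^sub>v a"
      and sumc: "Bt\<^sup>T *\<^sub>v a + Br\<^sup>T *\<^sub>v b \<in> carrier_vec n"
      if ab: "a \<in> carrier_vec t" "b \<in> carrier_vec r" for a b
    proof -
      have d: "Bt\<^sup>T *\<^sub>v a \<in> carrier_vec n" "Br\<^sup>T *\<^sub>v b \<in> carrier_vec n"
        using T ab by (meson mult_mat_vec_carrier)+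
      have Sb: "?S *\<^sub>v b \<in> carrier_vec r" and Ma: "M *\<^sub>v a \<in> carrier_vec t"
        using mult_mat_vec_carrier[OF S] mult_mat_vec_carrier[OF M] ab by auto
      show "Bt\<^sup>T *\<^sub>v a + Br\<^sup>T *\<^sub>v b \<in> carrier_vec n" using d by simp
      have "Br *\<^sub>v (Bt\<^sup>T *\<^sub>v a) = 0\<^sub>v r" "Bt *\<^sub>v (Br\<^sup>T *\<^sub>v b) = 0\<^sub>v t"
        using assoc_mult_mat_vec[OF Br T(2) ab(1), symmetric] assoc_mult_mat_vec[OF Bt T(1) ab(2), symmetric]
          orth orth' zero_mat_mult_vec[OF ab(1)] zero_mat_mult_vec[OF ab(2)] by simp_all
      note zero = this
      show "Br *\<^sub>v (Bt\<^sup>T *\<^sub>v a + Br\<^sup>T *\<^sub>v b) = ?S *\<^sub>v b"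
        using mult_add_distrib_mat_vec[OF Br d] zero(1) Sb assoc_mult_mat_vec[OF Br T(1) ab(2)] by simp
      show "Bt *\<^sub>v (Bt\<^sup>T *\<^sub>v a + Br\<^sup>T *\<^sub>v b) = M *\<^sub>v a"
        using mult_add_distrib_mat_vec[OF Bt d] zero(2) Ma assoc_mult_mat_vec[OF Bt T(2) ab(1)]
        by (simp add: M_def)
    qed
    have AMu: "A *\<^sub>v (M *\<^sub>v u) \<in> carrier_vec t" "M *\<^sub>v (A\<^sup>T *\<^sub>v u) \<in> carrier_vec t"
      using A M Au c by (meson mult_mat_vec_carrier)+
    have "?K *\<^sub>v u = A *\<^sub>v (M *\<^sub>v u) - M *\<^sub>v (A\<^sup>T *\<^sub>v u)"
      using A M T c minus_mult_distrib_mat_vec[of "A * M" t t "M * A\<^sup>T" u]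
      by (simp add: assoc_mult_mat_vec[of _ t t])
    moreover have "a - b = 0\<^sub>v t \<longleftrightarrow> b = a" if "a \<in> carrier_vec t" "b \<in> carrier_vec t" for a b :: "'a vec"
      using that by (auto simp: vec_eq_iff)
    ultimately have "?K *\<^sub>v u = 0\<^sub>v t \<longleftrightarrow> M *\<^sub>v (A\<^sup>T *\<^sub>v u) = A *\<^sub>v (M *\<^sub>v u)"
      using AMu by simp
    then show ?thesis
      using sdual_rowsp_DA_gen[OF Br Bt A sumc[OF c(1,2)] sumc[OF Au c(3)]] sum1 sum2 c Au
      by (auto simp: D_def mat_kernel[OF K] mat_kernel[OF S])
  qed
  then have "D \<inter> sdual n D = ?\<phi> ` (mat_kernel ?K \<times> mat_kernel ?S \<times> mat_kernel ?S)"
    unfolding D_eq using mat_kernel_carrier[OF K] mat_kernel_carrier[OF S] by blast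
  moreover have "inj_on ?\<phi> (mat_kernel ?K \<times> mat_kernel ?S \<times> mat_kernel ?S)"
    by (rule inj_on_subset[OF inj]) (use mat_kernel_carrier[OF K] mat_kernel_carrier[OF S] in auto)
  ultimately show "card (D \<inter> sdual n D) = card (mat_kernel ?K) * card (mat_kernel ?S) ^ 2"
    by (simp add: card_image card_cartesian_product power2_eq_square)
qed

text \<open>In a relation \<open>M\<^sup>T *\<^sub>v u + N\<^sup>T *\<^sub>v v = 0\<close> the first
  summand lies in both row spaces, so both summands vanish.\<close>

lemma mat_kernel_append_rows_transpose:
  fixes M N :: "'a :: field mat"
  assumes M: "M \<in> carrier_mat k m" and N: "N \<in> carrier_mat l m"
    and kM: "mat_kernel M\<^sup>T = {0\<^sub>v k}" and kN: "mat_kernel N\<^sup>T = {0\<^sub>v l}"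
    and int: "rowsp M \<inter> rowsp N = {0\<^sub>v m}"
  shows "mat_kernel (M @\<^sub>r N)\<^sup>T = {0\<^sub>v (k + l)}"
proof -
  have MN: "(M @\<^sub>r N)\<^sup>T \<in> carrier_mat m (k + l)" and MT: "M\<^sup>T \<in> carrier_mat m k" and NT: "N\<^sup>T \<in> carrier_mat m l"
    using M N by auto
  have "u = 0\<^sub>v k \<and> v = 0\<^sub>v l"
    if u: "u \<in> carrier_vec k" and v: "v \<in> carrier_vec l" and eq: "(M @\<^sub>r N)\<^sup>T *\<^sub>v (u @\<^sub>v v) = 0\<^sub>v m" for u v
  proof -
    have c: "M\<^sup>T *\<^sub>v u \<in> carrier_vec m" "N\<^sup>T *\<^sub>v v \<in> carrier_vec m"
      using MT NT u v by (meson mult_mat_vec_carrier)+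
    have sum: "M\<^sup>T *\<^sub>v u + N\<^sup>T *\<^sub>v v = 0\<^sub>v m"
      using eq transpose_append_rows_mult_vec[OF M N u v] by simp
    moreover have "a = - b" if "a + b = 0\<^sub>v m" "a \<in> carrier_vec m" "b \<in> carrier_vec m" for a b :: "'a vec"
      using that by (auto simp: vec_eq_iff eq_neg_iff_add_eq_0)
    ultimately have "M\<^sup>T *\<^sub>v u = - (N\<^sup>T *\<^sub>v v)" using c by blast
    also have "\<dots> = N\<^sup>T *\<^sub>v (- v)"
      using NT v c by (auto simp: vec_eq_iff)
    finally have "M\<^sup>T *\<^sub>v u \<in> rowsp N"
      using v unfolding rowsp_eq_image[OF N] by (intro image_eqI[where x = "- v"]) auto
    moreover have "M\<^sup>T *\<^sub>v u \<in> rowsp M" using u by (simp add: rowsp_eq_image[OF M])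
    ultimately have Mu: "M\<^sup>T *\<^sub>v u = 0\<^sub>v m" using int by blast
    then have "u \<in> mat_kernel M\<^sup>T" using u by (simp add: mat_kernel[OF MT])
    moreover have "N\<^sup>T *\<^sub>v v = 0\<^sub>v m"
      using sum c unfolding Mu by simp
    then have "v \<in> mat_kernel N\<^sup>T" using v by (simp add: mat_kernel[OF NT])
    ultimately show ?thesis using kM kN by blast
  qed
  moreover have "0\<^sub>v (k + l) = (0\<^sub>v k @\<^sub>v 0\<^sub>v l :: 'a vec)" by auto
  ultimately have "mat_kernel (M @\<^sub>r N)\<^sup>T \<subseteq> {0\<^sub>v (k + l)}"
    unfolding mat_kernel[OF MN] carrier_vec_add_eq_append by fastforce
  moreover have "0\<^sub>v (k + l) \<in> mat_kernel (M @\<^sub>r N)\<^sup>T"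
    using mult_mat_zero_vec[OF MN] by (simp add: mat_kernel[OF MN])
  ultimately show ?thesis by blast
qed

section \<open>Minimum distance\<close>

text \<open>The bound is shown for every nonzero vector of the symplectic dual, whether or not it
  lies in the code. The two cases of the proof yield the two terms of the minimum.\<close>

lemma d_of_DA_gen_ge:
  fixes A Bt Br :: "'a :: {finite, field} mat"
  assumes Br: "Br \<in> carrier_mat r n" and Bt: "Bt \<in> carrier_mat t n" and A: "A \<in> carrier_mat t t"
    and ev: "\<forall>k. \<not> eigenvalue A k"
  shows "d_of n (rowsp (DA_gen A Bt Br)) \<ge>
    min (dH n (mat_kernel (Br @\<^sub>r Bt))) (ceil_factor CARD('a) (dH n (mat_kernel Br)))"
    (is "_ \<ge> min ?\<delta>1 (ceil_factor _ ?\<delta>2)")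
  unfolding d_of_def ds_def
proof (rule INF_greatest)
  fix z :: "'a vec"
  assume "z \<in> {z \<in> sdual n (rowsp (DA_gen A Bt Br)) - rowsp (DA_gen A Bt Br) \<inter> sdual n (rowsp (DA_gen A Bt Br)). z \<noteq> 0\<^sub>v (2 * n)}"
  then have z: "z \<in> sdual n (rowsp (DA_gen A Bt Br))" and nz: "z \<noteq> 0\<^sub>v (2 * n)" by auto
  have "z \<in> carrier_vec (n + n)" using z by (simp add: sdual_def mult_2)
  then obtain x y where x: "x \<in> carrier_vec n" and y: "y \<in> carrier_vec n" and zxy: "z = x @\<^sub>v y"
    unfolding carrier_vec_add_eq_append by auto
  have Brx: "Br *\<^sub>v x = 0\<^sub>v r" and Bry: "Br *\<^sub>v y = 0\<^sub>v r" and Bty: "Bt *\<^sub>v y = A *\<^sub>v (Bt *\<^sub>v x)"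
    using z sdual_rowsp_DA_gen[OF Br Bt A x y] zxy by auto
  have Btx: "Bt *\<^sub>v x \<in> carrier_vec t" using Bt x by (rule mult_mat_vec_carrier)
  show "min ?\<delta>1 (ceil_factor CARD('a) ?\<delta>2) \<le> enat (sweight n z)"
  proof (cases "Bt *\<^sub>v x = 0\<^sub>v t")
    case True
    have N: "Br @\<^sub>r Bt \<in> carrier_mat (r + t) n" using Br Bt by simp
    have "Bt *\<^sub>v y = 0\<^sub>v t" using Bty True mult_mat_zero_vec[OF A] by simp
    then have "x \<in> mat_kernel (Br @\<^sub>r Bt)" "y \<in> mat_kernel (Br @\<^sub>r Bt)"
      using True Brx Bry x y mat_mult_append[OF Br Bt x] mat_mult_append[OF Br Bt y]
      by (auto simp: mat_kernel[OF N])
    moreover have "x \<noteq> 0\<^sub>v n \<or> y \<noteq> 0\<^sub>v n" using nz zxy by (auto simp: mult_2)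
    \<comment> \<open>One nonzero half is enough, since its Hamming weight is at most the symplectic
      weight of the pair.\<close>
    ultimately obtain v where "v \<in> {x, y}" "v \<in> mat_kernel (Br @\<^sub>r Bt)" "v \<noteq> 0\<^sub>v n" by blast
    then have "?\<delta>1 \<le> enat (hweight v)" and "hweight v \<le> sweight n z"
      using dH_le hweight_le_sweight[OF x y] zxy by auto
    then have "?\<delta>1 \<le> enat (sweight n z)" by (meson enat_ord_simps(1) order_trans)
    then show ?thesis by (simp add: min.coboundedI1)
  next
    case False
    let ?v = "\<lambda>a b. a \<cdot>\<^sub>v x + b \<cdot>\<^sub>v y"
    have v: "?\<delta>2 \<le> enat (hweight (?v a b))" if ab: "(a, b) \<noteq> (0, 0)" for a b
    proof (rule dH_le)
      have "Br *\<^sub>v ?v a b = 0\<^sub>v r"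
        using mult_add_distrib_mat_vec[OF Br] mult_mat_vec[OF Br] x y Brx Bry by auto
      then show "?v a b \<in> mat_kernel Br" using x y by (simp add: mat_kernel[OF Br])
      show "?v a b \<noteq> 0\<^sub>v n"
      proof
        assume "?v a b = 0\<^sub>v n"
        then have "Bt *\<^sub>v ?v a b = 0\<^sub>v t" using mult_mat_zero_vec[OF Bt] by simp
        then have lin: "a \<cdot>\<^sub>v (Bt *\<^sub>v x) + b \<cdot>\<^sub>v (A *\<^sub>v (Bt *\<^sub>v x)) = 0\<^sub>v t"
          using mult_add_distrib_mat_vec[OF Bt, of "a \<cdot>\<^sub>v x" "b \<cdot>\<^sub>v y"] mult_mat_vec[OF Bt] x y Bty by simp
        have Av: "A *\<^sub>v (Bt *\<^sub>v x) \<in> carrier_vec t" using A Btx by (rule mult_mat_vec_carrier)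
        have pt: "a * (Bt *\<^sub>v x) $ i + b * (A *\<^sub>v (Bt *\<^sub>v x)) $ i = 0" if "i < t" for i
          using arg_cong[OF lin, of "\<lambda>v. v $ i"] that A Bt by simp
        \<comment> \<open>With \<open>b = 0\<close> the coefficient \<open>a\<close> is nonzero and
          \<open>Bt *\<^sub>v x\<close> would vanish; otherwise \<open>Bt *\<^sub>v x\<close> is an
          eigenvector for \<open>- a / b\<close>.\<close>
        show False
        proof (cases "b = 0")
          case True
          with pt ab have "(Bt *\<^sub>v x) $ i = 0" if "i < t" for i using that by simp
          then have "Bt *\<^sub>v x = 0\<^sub>v t" using Bt by (intro eq_vecI) (simp_all del: index_mult_mat_vec)
          with False show False by simp
        next
          case b: False
          have "(A *\<^sub>v (Bt *\<^sub>v x)) $ i = (- a / b) * (Bt *\<^sub>v x) $ i" if "i < t" for i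
            using pt[OF that] b by (simp add: field_simps eq_neg_iff_add_eq_0)
          then have "A *\<^sub>v (Bt *\<^sub>v x) = (- a / b) \<cdot>\<^sub>v (Bt *\<^sub>v x)"
            using A Bt by (intro eq_vecI) (simp_all del: index_mult_mat_vec)
          then have "eigenvalue A (- a / b)"
            unfolding eigenvalue_def eigenvector_def using False Btx A by auto
          with ev show False by blast
        qed
      qed
    qed
    \<comment> \<open>The pair \<open>(1, 0)\<close> bounds the distance by the weight of a vector,
      so it is finite.\<close>
    then obtain k where k: "?\<delta>2 = enat k"
      using v[of 1 0] by (cases ?\<delta>2) auto
    have "(CARD('a) + 1) * k \<le> CARD('a) * sweight n z"
      unfolding zxy by (rule sweight_lower_bound[OF x y]) (use v k in auto)
    then have "ceil_factor CARD('a) ?\<delta>2 \<le> enat (sweight n z)"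
      unfolding k by (intro ceil_factor_le) auto
    then show ?thesis by (simp add: min.coboundedI2)
  qed
qed

section \<open>Assembly of the code parameters from the kernel counts\<close>

theorem theorem2p6:
  fixes Br Btl BtQ A0 A1 :: "'a :: {finite, field} mat"
    and n r t tl :: nat
  defines "Bt \<equiv> Btl @\<^sub>r BtQ"
  defines "C \<equiv> rowsp (Br @\<^sub>r Bt)"
  defines "Z \<equiv> Btl * transpose_mat Btl"
  defines "A \<equiv> four_block_mat (A0 * the (mat_inverse Z)) (0\<^sub>m tl (t - tl))
                              (0\<^sub>m (t - tl) tl) A1"
  defines "c \<equiv> int (code_dim n C) - int (code_dim n (C \<inter> edual n C))"
  assumes "n \<ge> 1" and "t \<ge> 2" and "tl \<le> t"
    and "Br \<in> carrier_mat r n" and "Btl \<in> carrier_mat tl n" and "BtQ \<in> carrier_mat (t - tl) n"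
    and "indep_rows Br" and "indep_rows Bt"
    and "rowsp Br \<inter> rowsp Bt = {0\<^sub>v n}"
    and "Br * transpose_mat Bt = 0\<^sub>m r t"
    and "rowsp BtQ \<subseteq> edual n (rowsp Bt)"
    and "Z_shape Z"
    and "A0 \<in> carrier_mat tl tl" and "A1 \<in> carrier_mat (t - tl) (t - tl)"
    and "invertible_mat A" and "\<forall>k. \<not> eigenvalue A k"
  shows "let D = rowsp (DA_gen A Bt Br);
             c' = (c - int tl) + int (mrank (A0 - transpose_mat A0)) div 2
         in c' = c - int (mrank (Bt * transpose_mat Bt)) + int (mrank (A0 - transpose_mat A0)) div 2
          \<and> c_of n D = c'
          \<and> k_of n D = int n - 2 * int r - int t + c'
          \<and> d_of n D \<ge> min (dH n (edual n C)) (ceil_factor (card (UNIV :: 'a set)) (dH n (edual n (rowsp Br))))"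
proof -
  note Br = \<open>Br \<in> carrier_mat r n\<close> and Btl = \<open>Btl \<in> carrier_mat tl n\<close>
    and BtQ = \<open>BtQ \<in> carrier_mat (t - tl) n\<close> and A0 = \<open>A0 \<in> carrier_mat tl tl\<close>
    and A1 = \<open>A1 \<in> carrier_mat (t - tl) (t - tl)\<close> and orth = \<open>Br * Bt\<^sup>T = 0\<^sub>m r t\<close> and tl = \<open>tl \<le> t\<close>
  let ?l = "t - tl" and ?q = "CARD('a)"
  define M where "M = Bt * Bt\<^sup>T"
  define S where "S = Br * Br\<^sup>T"
  define D where "D = rowsp (DA_gen A Bt Br)"
  let ?R = "A0 - A0\<^sup>T"
  have Bt: "Bt \<in> carrier_mat t n"
    using carrier_append_rows[OF Btl BtQ] tl by (simp add: Bt_def)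
  have Z: "Z \<in> carrier_mat tl tl" using Btl by (simp add: Z_def)
  have S: "S \<in> carrier_mat r r" using Br by (simp add: S_def)
  have N: "Br @\<^sub>r Bt \<in> carrier_mat (r + t) n" using Br Bt by simp
  have Zt: "Z\<^sup>T = Z" using transpose_mult[OF Btl, of "Btl\<^sup>T" tl] Btl by (simp add: Z_def)
  obtain W where inv: "mat_inverse Z = Some W" and ZW: "Z * W = 1\<^sub>m tl" and WZ: "W * Z = 1\<^sub>m tl"
    and W: "W \<in> carrier_mat tl tl"
    using mat_inverse_eq_Some[OF Z Z_shape_det[OF \<open>Z_shape Z\<close>]] .
  have A_eq: "A = four_block_mat (A0 * W) (0\<^sub>m tl ?l) (0\<^sub>m ?l tl) A1"
    by (simp add: A_def inv)
  have A: "A \<in> carrier_mat t t"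
    using four_block_carrier_mat[of "A0 * W" tl tl A1 ?l ?l] A0 W A1 tl by (simp add: A_eq)

  have BtBtQ: "Bt *\<^sub>v (BtQ\<^sup>T *\<^sub>v y) = 0\<^sub>v t" if "y \<in> carrier_vec ?l" for y
    using \<open>rowsp BtQ \<subseteq> edual n (rowsp Bt)\<close> that
    by (auto simp: edual_rowsp[OF Bt] rowsp_eq_image[OF BtQ] mat_kernel[OF Bt])
  \<comment> \<open>The rows of \<open>BtQ\<close> are orthogonal to all of \<open>Bt\<close>;
    reading this blockwise kills every block of \<open>M\<close> except \<open>Z\<close>.\<close>
  have split: "Btl *\<^sub>v (BtQ\<^sup>T *\<^sub>v y) = 0\<^sub>v tl \<and> BtQ *\<^sub>v (BtQ\<^sup>T *\<^sub>v y) = 0\<^sub>v ?l" if y: "y \<in> carrier_vec ?l" for y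
  proof -
    have c: "BtQ\<^sup>T *\<^sub>v y \<in> carrier_vec n" using BtQ y by (auto intro!: mult_mat_vec_carrier)
    have "0\<^sub>v t = (0\<^sub>v tl @\<^sub>v 0\<^sub>v ?l :: 'a vec)" using tl by auto
    then have "(Btl *\<^sub>v (BtQ\<^sup>T *\<^sub>v y)) @\<^sub>v (BtQ *\<^sub>v (BtQ\<^sup>T *\<^sub>v y)) = 0\<^sub>v tl @\<^sub>v 0\<^sub>v ?l"
      using BtBtQ[OF y] mat_mult_append[OF Btl BtQ c] by (simp add: Bt_def)
    then show ?thesis
      using append_vec_eq[OF mult_mat_vec_carrier[OF Btl c] zero_carrier_vec] by blast
  qed
  have QT: "BtQ\<^sup>T \<in> carrier_mat n ?l" using BtQ by simp
  have lQ: "Btl * BtQ\<^sup>T = 0\<^sub>m tl ?l" using split by (intro mult_mat_eq_0I[OF Btl QT]) blast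
  have QQ: "BtQ * BtQ\<^sup>T = 0\<^sub>m ?l ?l" using split by (intro mult_mat_eq_0I[OF BtQ QT]) blast
  have M_eq: "M = four_block_mat Z (0\<^sub>m tl ?l) (0\<^sub>m ?l tl) (0\<^sub>m ?l ?l)"
    unfolding M_def Bt_def append_rows_mult_transpose[OF Btl BtQ] lQ QQ
      mult_mat_transpose_swap[OF Btl BtQ lQ] Z_def ..
  have M: "M \<in> carrier_mat t t" using Bt by (simp add: M_def)

  \<comment> \<open>The factor \<open>W\<close> in \<open>A\<close> is there to cancel
    \<open>Z\<close>, while \<open>A1\<close> only meets the zero block of \<open>M\<close>.\<close>
  have "A0 * W * Z = A0"
    using assoc_mult_mat[OF A0 W Z] WZ A0 by simp
  then have AM: "A * M = four_block_mat A0 (0\<^sub>m tl ?l) (0\<^sub>m ?l tl) (0\<^sub>m ?l ?l)"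
    unfolding A_eq M_eq using A0 W A1 Z
    by (subst mult_four_block_mat[of _ tl tl _ ?l _ ?l _ _ tl _ ?l]) auto
  \<comment> \<open>This holds because the Gram matrix \<open>M\<close> is symmetric.\<close>
  have "M * A\<^sup>T = (A * M)\<^sup>T"
    using transpose_mult[OF A M] transpose_mult[OF Bt, of "Bt\<^sup>T" t] Bt by (simp add: M_def)
  also have "\<dots> = four_block_mat A0\<^sup>T (0\<^sub>m tl ?l) (0\<^sub>m ?l tl) (0\<^sub>m ?l ?l)"
    unfolding AM using A0 by (subst transpose_four_block_mat[of _ tl tl _ ?l _ ?l]) auto
  finally have K_eq: "A * M - M * A\<^sup>T = four_block_mat ?R (0\<^sub>m tl ?l) (0\<^sub>m ?l tl) (0\<^sub>m ?l ?l)"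
    unfolding AM using A0 by (intro eq_matI) auto
  have R: "?R \<in> carrier_mat tl tl" using A0 by (intro minus_carrier_mat) simp

  have kBr: "mat_kernel Br\<^sup>T = {0\<^sub>v r}" and kBt: "mat_kernel Bt\<^sup>T = {0\<^sub>v t}"
    using mat_kernel_transpose_indep Br Bt \<open>indep_rows Br\<close> \<open>indep_rows Bt\<close> by blast+
  have kN: "mat_kernel (Br @\<^sub>r Bt)\<^sup>T = {0\<^sub>v (r + t)}"
    by (rule mat_kernel_append_rows_transpose[OF Br Bt kBr kBt \<open>rowsp Br \<inter> rowsp Bt = {0\<^sub>v n}\<close>])

  define \<rho> where "\<rho> = mrank S"
  define \<kappa> where "\<kappa> = mrank ?R"
  have \<rho>: "\<rho> \<le> r" and \<kappa>: "\<kappa> \<le> tl" using mrank_le[OF S] mrank_le[OF R] by (simp_all add: \<rho>_def \<kappa>_def)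
  have cS: "card (mat_kernel S) = ?q ^ (r - \<rho>)" and cR: "card (mat_kernel ?R) = ?q ^ (tl - \<kappa>)"
    using card_mat_kernel[OF S] card_mat_kernel[OF R] by (simp_all add: \<rho>_def \<kappa>_def)
  have "mat_kernel Z = {0\<^sub>v tl}"
  proof -
    have "v = 0\<^sub>v tl" if "v \<in> carrier_vec tl" "Z *\<^sub>v v = 0\<^sub>v tl" for v
      using assoc_mult_mat_vec[OF W Z that(1)] that WZ mult_mat_zero_vec[OF W] by simp
    then show ?thesis using mult_mat_zero_vec[OF Z] by (auto simp: mat_kernel[OF Z])
  qed
  then have cM: "card (mat_kernel M) = ?q ^ ?l"
    unfolding M_eq card_mat_kernel_block_diag[OF Z zero_carrier_mat]
    by (simp add: mat_kernel_zero card_carrier_vec)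
  have q: "?q > 1" using card_mono[of UNIV "{0, 1 :: 'a}"] by simp
  \<comment> \<open>Comparing exponents of the two kernel counts; this value identifies the two
    expressions for \<open>c'\<close>.\<close>
  have rM: "mrank M = tl"
    using card_mat_kernel[OF M] cM q mrank_le[OF M] tl by simp

  have "card (mat_kernel ((Br @\<^sub>r Bt) * (Br @\<^sub>r Bt)\<^sup>T)) = card (mat_kernel S) * card (mat_kernel M)"
    unfolding append_rows_mult_transpose[OF Br Bt] orth mult_mat_transpose_swap[OF Br Bt orth]
      S_def[symmetric] M_def[symmetric] by (rule card_mat_kernel_block_diag[OF S M])
  then have "card (C \<inter> edual n C) = ?q ^ ((r - \<rho>) + ?l)"
    unfolding C_def card_rowsp_Int_edual[OF N kN] cS cM by (simp add: power_add)
  moreover have "VectorSpace.subspace class_ring (C \<inter> edual n C) (module_vec TYPE('a) n)"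
    unfolding C_def edual_rowsp[OF N]
    by (intro subspace_Int_vec subspace_rowsp[OF N] subspace_mat_kernel[OF N])
  ultimately have "code_dim n (C \<inter> edual n C) = (r - \<rho>) + ?l" by (rule code_dim_eqI[rotated])
  moreover have "code_dim n C = r + t" unfolding C_def by (rule code_dim_rowsp[OF N kN])
  \<comment> \<open>The radical of \<open>C\<close> has dimension
    \<open>(r - \<rho>) + (t - tl)\<close>, to be subtracted from \<open>r + t\<close>.\<close>
  ultimately have c: "c = int \<rho> + int tl" using \<rho> tl by (simp add: c_def)

  note rad = DA_gen_radical[OF Br Bt A kBr kN orth, folded M_def S_def D_def]
  have G: "DA_gen A Bt Br \<in> carrier_mat (t + (r + r)) (2 * n)"
    using rowsp_DA_gen(1)[OF Br Bt A] by (simp add: mult_2)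
  have subD: "VectorSpace.subspace class_ring D (module_vec TYPE('a) (2 * n))"
    unfolding D_def by (rule subspace_rowsp[OF G])
  have dimD: "code_dim (2 * n) D = t + (r + r)" by (rule code_dim_eqI[OF subD rad(1)])
  have "card (D \<inter> sdual n D) = ?q ^ ((tl - \<kappa>) + ?l + 2 * (r - \<rho>))"
    unfolding rad(2) K_eq card_mat_kernel_block_diag[OF R zero_carrier_mat] cS cR
    by (simp add: mat_kernel_zero card_carrier_vec power_add mult_2 power2_eq_square)
  then have "code_dim (2 * n) (D \<inter> sdual n D) = (tl - \<kappa>) + ?l + 2 * (r - \<rho>)"
    by (intro code_dim_eqI subspace_Int_vec[OF subD subspace_sdual])
  then have "int (code_dim (2 * n) D) - int (code_dim (2 * n) (D \<inter> sdual n D)) = int \<kappa> + 2 * int \<rho>"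
    using dimD \<rho> \<kappa> tl by simp
  \<comment> \<open>The even summand \<open>2 * \<rho>\<close> passes through \<open>div 2\<close>
    exactly, and \<open>\<rho>\<close> equals \<open>c - tl\<close>.\<close>
  then have c_of: "c_of n D = c - int tl + int \<kappa> div 2"
    unfolding c_of_def c by simp
  have k_of: "k_of n D = int n - 2 * int r - int t + (c - int tl + int \<kappa> div 2)"
    unfolding k_of_def c_of dimD by simp
  have d_of: "d_of n D \<ge> min (dH n (edual n C)) (ceil_factor ?q (dH n (edual n (rowsp Br))))"
    using d_of_DA_gen_ge[OF Br Bt A \<open>\<forall>k. \<not> eigenvalue A k\<close>]
    by (simp add: D_def C_def edual_rowsp[OF N] edual_rowsp[OF Br])
  show ?thesis
    using c_of k_of d_of rM by (simp add: Let_def D_def M_def \<kappa>_def)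
qed
end
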